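(* Let $(X,d)$ be a metric space with metric tight span $(T^d_X,d_T)$. Let $(X,\delta)$ be the associated diameter diversity, where $\delta=\mathrm{diam}_d$, and let $(T^\delta_X,\delta_T)$ be its diversity tight span. Then: 1. The metric space obtained by restricting $\delta_T$ to pairs in $T^\delta_X$ (that is, with metric $(f,g)\mapsto\delta_T(\{f,g\})$) is isometric to the metric space $(T^d_X,d_T)$. 2. The diversity obtained by taking the diameter on the metric space $(T^d_X,d_T)$, i.e. $(T^d_X,\mathrm{diam}_{d_T})$, is isomorphic to the diversity $(T^\delta_X,\delta_T)$.
   Context: For a set $X$, $\mathcal{P}_{\mathrm{fin}}(X)$ denotes the set of all finite subsets of $X$. A diversity is a pair $(X,\delta)$ where $X$ is a set and $\delta:\mathcal{P}_{\mathrm{fin}}(X)\to\mathbb{R}$ satisfies, for all finite $A,B,C\subseteq X$: (D1) $\delta(A)\ge 0$, and $\delta(A)=0$ if and only if $|A|\le 1$; (D2) if $B\ne\emptyset$ then $\delta(A\cup C)\le\delta(A\cup B)+\delta(B\cup C)$. An isomorphism of diversities $(Y_1,\delta_1)\to(Y_2,\delta_2)$ is a bijection $\pi:Y_1\to Y_2$ with $\delta_1(A)=\delta_2(\pi(A))$ for all finite $A\subseteq Y_1$. Metric tight span: for a metric space $(X,d)$, $T^d_X$ is the set of pointwise minimal functions among all $f:X\to\mathbb{R}$ with $f(a_1)+f(a_2)\ge d(a_1,a_2)$ for all $a_1,a_2\in X$, equipped with the metric $d_T(f,g)=\sup_{x\in X}|f(x)-g(x)|$. Diameter diversity: for a metric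 space $(X,d)$, $\mathrm{diam}_d(A)=\max\{d(a,a'):a,a'\in A\}$ for finite non-empty $A\subseteq X$ and $\mathrm{diam}_d(\emptyset)=0$; $(X,\mathrm{diam}_d)$ is a diversity. Diversity tight span: given a diversity $(X,\delta)$, $P_X$ is the set of all functions $f:\mathcal{P}_{\mathrm{fin}}(X)\to\mathbb{R}$ with $f(\emptyset)=0$ and $\sum_{A\in\mathscr{A}}f(A)\ge\delta\big(\bigcup_{A\in\mathscr{A}}A\big)$ for all finite $\mathscr{A}\subseteq\mathcal{P}_{\mathrm{fin}}(X)$. Write $f\preceq g$ if $f(A)\le g(A)$ for all finite $A\subseteq X$. $T^\delta_X$ is the set of elements of $P_X$ that are minimal with respect to $\preceq$, and $\delta_T:\mathcal{P}_{\mathrm{fin}}(T^\delta_X)\to\mathbb{R}$ is defined by $\delta_T(\emptyset)=0$ and, for finite non-empty $F\subseteq T^\delta_X$, $$\delta_T(F)=\sup\left\{\delta\Big(\bigcup_{A\in\mathscr{A}}A\Big)-\sum_{A\in\mathscr{A}}\inf_{f\in F}f(A):\ \mathscr{A}\subseteq\mathcal{P}_{\mathrm{fin}}(X),\ |\mathscr{A}|<\infty\right\}.$$ The pair $(T^\delta_X,\delta_T)$ is a diversity. *)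

theory Defs
  imports "HOL-Analysis.Analysis"
begin

text \<open>
  Functions on a carrier are represented as extensional functions, so that equality of
  members of a tight span is equality on the carrier. Metrics and diversities are total
  HOL functions; only their values on the carrier, respectively on \<^term>\<open>Fpow X\<close>
  (the finite subsets of \<^term>\<open>X\<close>), matter.
\<close>

locale diversity =
  fixes X :: "'a set" and \<delta> :: "'a set \<Rightarrow> real"
  assumes nonneg: "A \<in> Fpow X \<Longrightarrow> 0 \<le> \<delta> A"
    and zero_iff: "A \<in> Fpow X \<Longrightarrow> \<delta> A = 0 \<longleftrightarrow> card A \<le> 1"
    and triangle: "\<lbrakk>A \<in> Fpow X; B \<in> Fpow X; C \<in> Fpow X; B \<noteq> {}\<rbrakk>
      \<Longrightarrow> \<delta> (A \<union> C) \<le> \<delta> (A \<union> B) + \<delta> (B \<union> C)"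

definition diversity_isomorphism ::
  "('a \<Rightarrow> 'b) \<Rightarrow> 'a set \<Rightarrow> ('a set \<Rightarrow> real) \<Rightarrow> 'b set \<Rightarrow> ('b set \<Rightarrow> real) \<Rightarrow> bool" where
  "diversity_isomorphism \<pi> Y1 \<delta>1 Y2 \<delta>2 \<longleftrightarrow>
     diversity Y1 \<delta>1 \<and> diversity Y2 \<delta>2 \<and>
     bij_betw \<pi> Y1 Y2 \<and> (\<forall>A\<in>Fpow Y1. \<delta>1 A = \<delta>2 (\<pi> ` A))"

definition isomorphic_diversities ::
  "'a set \<Rightarrow> ('a set \<Rightarrow> real) \<Rightarrow> 'b set \<Rightarrow> ('b set \<Rightarrow> real) \<Rightarrow> bool" where
  "isomorphic_diversities Y1 \<delta>1 Y2 \<delta>2 \<longleftrightarrow> (\<exists>\<pi>. diversity_isomorphism \<pi> Y1 \<delta>1 Y2 \<delta>2)"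

definition isometric_metric_spaces ::
  "'a set \<Rightarrow> ('a \<Rightarrow> 'a \<Rightarrow> real) \<Rightarrow> 'b set \<Rightarrow> ('b \<Rightarrow> 'b \<Rightarrow> real) \<Rightarrow> bool" where
  "isometric_metric_spaces M1 d1 M2 d2 \<longleftrightarrow>
     Metric_space M1 d1 \<and> Metric_space M2 d2 \<and>
     (\<exists>\<phi>. bij_betw \<phi> M1 M2 \<and> (\<forall>x\<in>M1. \<forall>y\<in>M1. d2 (\<phi> x) (\<phi> y) = d1 x y))"

definition diam :: "('a \<Rightarrow> 'a \<Rightarrow> real) \<Rightarrow> 'a set \<Rightarrow> real" where
  "diam d A = (if A = {} then 0 else Max {d a a' | a a'. a \<in> A \<and> a' \<in> A})"

definition metric_upper_functions :: "'a set \<Rightarrow> ('a \<Rightarrow> 'a \<Rightarrow> real) \<Rightarrow> ('a \<Rightarrow> real) set" where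
  "metric_upper_functions X d =
     {f \<in> X \<rightarrow>\<^sub>E UNIV. \<forall>a1\<in>X. \<forall>a2\<in>X. f a1 + f a2 \<ge> d a1 a2}"

definition metric_tight_span :: "'a set \<Rightarrow> ('a \<Rightarrow> 'a \<Rightarrow> real) \<Rightarrow> ('a \<Rightarrow> real) set" where
  "metric_tight_span X d =
     {f \<in> metric_upper_functions X d.
        \<forall>g\<in>metric_upper_functions X d. (\<forall>x\<in>X. g x \<le> f x) \<longrightarrow> g = f}"

text \<open>
  The value is 0 outside the tight span because the locale \<^const>\<open>Metric_space\<close> constrains
  distances off the carrier as well. If \<^term>\<open>X\<close> is empty, the tight span is a single point
  and the supremum of the empty set of absolute values is read as 0.
\<close>

definition metric_tight_span_dist ::
  "'a set \<Rightarrow> ('a \<Rightarrow> 'a \<Rightarrow> real) \<Rightarrow> ('a \<Rightarrow> real) \<Rightarrow> ('a \<Rightarrow> real) \<Rightarrow> real" where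
  "metric_tight_span_dist X d f g =
     (if X \<noteq> {} \<and> f \<in> metric_tight_span X d \<and> g \<in> metric_tight_span X d
      then SUP x\<in>X. \<bar>f x - g x\<bar> else 0)"

definition diversity_upper_functions ::
  "'a set \<Rightarrow> ('a set \<Rightarrow> real) \<Rightarrow> ('a set \<Rightarrow> real) set" where
  "diversity_upper_functions X \<delta> =
     {f \<in> Fpow X \<rightarrow>\<^sub>E UNIV. f {} = 0 \<and>
        (\<forall>\<A>. finite \<A> \<and> \<A> \<subseteq> Fpow X \<longrightarrow> (\<Sum>A\<in>\<A>. f A) \<ge> \<delta> (\<Union>\<A>))}"

definition diversity_tight_span ::
  "'a set \<Rightarrow> ('a set \<Rightarrow> real) \<Rightarrow> ('a set \<Rightarrow> real) set" where
  "diversity_tight_span X \<delta> =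
     {f \<in> diversity_upper_functions X \<delta>.
        \<forall>g\<in>diversity_upper_functions X \<delta>. (\<forall>A\<in>Fpow X. g A \<le> f A) \<longrightarrow> g = f}"

text \<open>
  The value is 0 on the empty set by definition; it is also set to 0 on sets that are not
  finite subsets of the tight span, again with \<^const>\<open>Metric_space\<close> in mind.
\<close>

definition diversity_tight_span_div ::
  "'a set \<Rightarrow> ('a set \<Rightarrow> real) \<Rightarrow> ('a set \<Rightarrow> real) set \<Rightarrow> real" where
  "diversity_tight_span_div X \<delta> F =
     (if F \<in> Fpow (diversity_tight_span X \<delta>) \<and> F \<noteq> {}
      then Sup {\<delta> (\<Union>\<A>) - (\<Sum>A\<in>\<A>. INF f\<in>F. f A) | \<A>. \<A> \<subseteq> Fpow X \<and> finite \<A>}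
      else 0)"

end

theory Submission
  imports Defs
begin

text \<open>
  Both tight spans are determined by the values on single points. A function \<open>f\<close> in the metric
  tight span extends to finite sets by \<open>E f A = max (diam A) (max\<^sub>a\<^sub>\<in>\<^sub>A f a)\<close>, and this is the only
  candidate: a minimal function on finite sets is monotone, so its value at \<open>A\<close> is at least each
  of its values at points of \<open>A\<close>, and it is at least \<open>diam A\<close> because it dominates the diversity.
  On the other hand \<open>E f\<close> already dominates the diversity whenever \<open>f\<close> dominates the metric. The
  diameter of a union of sets is a distance between two points; if they lie in one member \<open>A\<close>, it
  is at most \<open>diam A\<close>, and if they lie in two different members, it is at most the sum of the
  values of \<open>f\<close> at the two points. Hence \<open>E\<close> and restriction to singletons are mutually inverse
  bijections of the tight spans (\<open>bij_betw_diameter_extension\<close>).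

  It remains to compare distances. Minimality of \<open>f\<close> says that \<open>f a\<close> is the least \<open>c \<ge> 0\<close> with
  \<open>d a b \<le> c + f b\<close> for all \<open>b\<close> (\<open>metric_tight_span_le\<close>). If \<open>s\<close> denotes the supremum that
  defines the tight span diversity at the functions \<open>E f\<close> for \<open>f \<in> S\<close>, then testing it on two
  singletons shows that \<open>c = s + g x\<close> is admissible for \<open>f\<close> at \<open>x\<close>, so \<open>f x - g x \<le> s\<close>. In the
  other direction, only two points and the two members that contain them matter for a diameter, and
  \<open>d a b - f a - g b \<le> f b - g b\<close>. So the tight span diversity is the diameter for the supremum
  distance (\<open>diversity_tight_span_div_eq_diam\<close>). Both claims follow by transport along \<open>E\<close>.
\<close>

section \<open>The diameter diversity\<close>

lemma FpowI: "finite A \<Longrightarrow> A \<subseteq> X \<Longrightarrow> A \<in> Fpow X"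
  by (simp add: Fpow_def)

lemma FpowD: "A \<in> Fpow X \<Longrightarrow> finite A" "A \<in> Fpow X \<Longrightarrow> A \<subseteq> X"
  by (simp_all add: Fpow_def)

lemma Union_in_Fpow: "finite \<A> \<Longrightarrow> \<A> \<subseteq> Fpow X \<Longrightarrow> \<Union>\<A> \<in> Fpow X"
  by (auto simp: Fpow_def)

lemma finite_distances: "finite A \<Longrightarrow> finite {d a a' | a a'. a \<in> A \<and> a' \<in> A}"
  by (rule finite_image_set2) auto

lemma diam_empty [simp]: "diam d {} = 0"
  by (simp add: diam_def)

lemma diam_singleton: "diam d {a} = d a a"
  by (simp add: diam_def)

lemma le_diam:
  assumes "finite A" "a \<in> A" "b \<in> A"
  shows "d a b \<le> diam d A"
  using assms finite_distances[of A d] unfolding diam_def by (auto intro!: Max_ge)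

lemma diam_attained:
  assumes "finite A" "A \<noteq> {}"
  obtains a b where "a \<in> A" "b \<in> A" "diam d A = d a b"
proof -
  have "diam d A \<in> {d a a' | a a'. a \<in> A \<and> a' \<in> A}"
    using assms finite_distances[of A d] unfolding diam_def by (simp del: mem_Collect_eq) (rule Max_in, auto)
  with that show ?thesis by blast
qed

lemma (in Metric_space) diam_nonneg:
  assumes "finite A"
  shows "0 \<le> diam d A"
proof (cases "A = {}")
  case False
  then obtain a b where "diam d A = d a b" using assms diam_attained by metis
  then show ?thesis by simp
qed simp

lemma (in Metric_space) diversity_diam: "diversity M (diam d)"
proof
  fix A assume A: "A \<in> Fpow M"
  show "0 \<le> diam d A" using FpowD[OF A] diam_nonneg by blast
  show "diam d A = 0 \<longleftrightarrow> card A \<le> 1"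
  proof
    assume 0: "diam d A = 0"
    have "a = b" if "a \<in> A" "b \<in> A" for a b
    proof -
      have "d a b \<le> 0" using le_diam[of A a b d] FpowD[OF A] that 0 by auto
      then show ?thesis using nonneg[of a b] zero[of a b] FpowD[OF A] that by auto
    qed
    then show "card A \<le> 1" by (simp add: card_le_Suc0_iff_eq FpowD[OF A])
  next
    assume "card A \<le> 1"
    then have same: "\<And>a b. a \<in> A \<Longrightarrow> b \<in> A \<Longrightarrow> a = b"
      by (simp add: card_le_Suc0_iff_eq FpowD[OF A])
    show "diam d A = 0"
    proof (cases "A = {}")
      case False
      then obtain a b where "a \<in> A" "b \<in> A" "diam d A = d a b"
        using FpowD[OF A] diam_attained by metis
      moreover have "a \<in> M" using \<open>a \<in> A\<close> FpowD[OF A] by blast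
      ultimately show ?thesis using same[of a b] by simp
    qed simp
  qed
next
  fix A B C assume A: "A \<in> Fpow M" and B: "B \<in> Fpow M" and C: "C \<in> Fpow M" and "B \<noteq> {}"
  then obtain b where b: "b \<in> B" by blast
  note fin = FpowD(1)[OF A] FpowD(1)[OF B] FpowD(1)[OF C]
  have 0: "0 \<le> diam d (A \<union> B)" "0 \<le> diam d (B \<union> C)" using fin by (auto intro: diam_nonneg)
  show "diam d (A \<union> C) \<le> diam d (A \<union> B) + diam d (B \<union> C)"
  proof (cases "A \<union> C = {}")
    case True then show ?thesis using 0 by simp
  next
    case False
    then obtain x y where xy: "x \<in> A \<union> C" "y \<in> A \<union> C" "diam d (A \<union> C) = d x y"
      using fin diam_attained by (metis finite_UnI)
    have M: "x \<in> M" "y \<in> M" "b \<in> M" using xy b FpowD[OF A] FpowD[OF B] FpowD[OF C] by auto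
    have AB: "u \<in> A \<union> B \<Longrightarrow> v \<in> A \<union> B \<Longrightarrow> d u v \<le> diam d (A \<union> B)"
      and BC: "u \<in> B \<union> C \<Longrightarrow> v \<in> B \<union> C \<Longrightarrow> d u v \<le> diam d (B \<union> C)" for u v
      using fin by (auto intro!: le_diam)
    consider "x \<in> A" "y \<in> A" | "x \<in> A" "y \<in> C" | "x \<in> C" "y \<in> A" | "x \<in> C" "y \<in> C"
      using xy by blast
    then show ?thesis
    proof cases
      case 1 then show ?thesis using AB[of x y] 0 xy by auto
    next
      case 2 then show ?thesis
        using AB[of x b] BC[of b y] triangle[of x b y] M xy b by auto
    next
      case 3 then show ?thesis
        using BC[of x b] AB[of b y] triangle[of x b y] M xy b by auto
    next
      case 4 then show ?thesis using BC[of x y] 0 xy by auto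
    qed
  qed
qed

text \<open>
  The triangle axiom for the sets \<open>A\<close>, \<open>{b}\<close>, \<open>{}\<close> shows that adding a single point cannot decrease the
  value.
\<close>

lemma (in diversity) mono:
  assumes "A \<subseteq> B" "B \<in> Fpow X"
  shows "\<delta> A \<le> \<delta> B"
proof -
  have "finite C \<Longrightarrow> C \<subseteq> X \<Longrightarrow> \<delta> A \<le> \<delta> (A \<union> C)" for C
  proof (induction C rule: finite_induct)
    case (insert b C)
    have F: "A \<union> C \<in> Fpow X" "{b} \<in> Fpow X" "{} \<in> Fpow X"
      using insert assms by (auto simp: Fpow_def intro: finite_subset)
    have "\<delta> (A \<union> C) \<le> \<delta> (A \<union> insert b C)"
      using triangle[OF F] zero_iff[OF F(2)] by simp
    then show ?case using insert by simp
  qed simp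
  moreover have "A \<union> B = B" using assms by blast
  ultimately show ?thesis using assms(2) by (metis FpowD)
qed

section \<open>Minimal functions\<close>

lemma metric_upper_functionsD:
  "f \<in> metric_upper_functions X d \<Longrightarrow> a \<in> X \<Longrightarrow> b \<in> X \<Longrightarrow> d a b \<le> f a + f b"
  by (simp add: metric_upper_functions_def)

lemma metric_tight_span_upper:
  "f \<in> metric_tight_span X d \<Longrightarrow> f \<in> metric_upper_functions X d"
  by (simp add: metric_tight_span_def)

lemma (in Metric_space) metric_upper_functions_nonneg:
  "f \<in> metric_upper_functions M d \<Longrightarrow> a \<in> M \<Longrightarrow> 0 \<le> f a"
  using metric_upper_functionsD[of f M d a a] by simp

text \<open>
  Otherwise the value at \<open>a\<close> could be lowered to \<open>c\<close>; the condition \<open>0 \<le> c\<close> covers the pair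
  \<open>(a, a)\<close>.
\<close>

lemma (in Metric_space) metric_tight_span_le:
  assumes f: "f \<in> metric_tight_span M d" and a: "a \<in> M" and c: "0 \<le> c"
    and adm: "\<And>b. b \<in> M \<Longrightarrow> d a b \<le> c + f b"
  shows "f a \<le> c"
proof (rule ccontr)
  assume "\<not> f a \<le> c"
  define g where "g = f(a := c)"
  have up: "f \<in> M \<rightarrow>\<^sub>E UNIV" "\<And>x y. x \<in> M \<Longrightarrow> y \<in> M \<Longrightarrow> d x y \<le> f x + f y"
    using metric_tight_span_upper[OF f] by (auto simp: metric_upper_functions_def)
  have "d x y \<le> g x + g y" if "x \<in> M" "y \<in> M" for x y
    using up(2)[OF that] adm[of x] adm[of y] that c commute[of x y] a
    by (auto simp: g_def)
  moreover have "g \<in> M \<rightarrow>\<^sub>E UNIV" using up(1) a by (auto simp: g_def PiE_def extensional_def)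
  ultimately have "g \<in> metric_upper_functions M d" by (simp add: metric_upper_functions_def)
  moreover have "\<forall>x\<in>M. g x \<le> f x" using \<open>\<not> f a \<le> c\<close> by (simp add: g_def)
  ultimately have "g = f" using f by (simp add: metric_tight_span_def)
  then have "g a = f a" by simp
  then show False using \<open>\<not> f a \<le> c\<close> by (simp add: g_def)
qed

lemma diversity_upper_functionsD:
  assumes "f \<in> diversity_upper_functions X \<delta>" "finite \<A>" "\<A> \<subseteq> Fpow X"
  shows "\<delta> (\<Union>\<A>) \<le> (\<Sum>A\<in>\<A>. f A)"
  using assms by (simp add: diversity_upper_functions_def)

lemma diversity_upper_functions_ge:
  assumes "f \<in> diversity_upper_functions X \<delta>" "A \<in> Fpow X"
  shows "\<delta> A \<le> f A"
  using diversity_upper_functionsD[OF assms(1), of "{A}"] assms(2) by simp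

lemma diversity_upper_functions_ge_pair:
  assumes "f \<in> diversity_upper_functions X \<delta>" "A \<in> Fpow X" "B \<in> Fpow X" "A \<noteq> B"
  shows "\<delta> (A \<union> B) \<le> f A + f B"
  using diversity_upper_functionsD[OF assms(1), of "{A,B}"] assms(2-4) by simp

lemma diversity_tight_span_upper:
  "f \<in> diversity_tight_span X \<delta> \<Longrightarrow> f \<in> diversity_upper_functions X \<delta>"
  by (simp add: diversity_tight_span_def)

text \<open>
  If \<open>f B < f A\<close>, the value at \<open>A\<close> could be lowered to \<open>f B\<close>: in every family that contains \<open>A\<close>,
  the set \<open>A\<close> can be replaced by the larger set \<open>B\<close> without decreasing the union.
\<close>

lemma (in diversity) diversity_tight_span_mono:
  assumes f: "f \<in> diversity_tight_span X \<delta>" and AB: "A \<subseteq> B" and B: "B \<in> Fpow X"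
  shows "f A \<le> f B"
proof (rule ccontr)
  assume less: "\<not> f A \<le> f B"
  have A: "A \<in> Fpow X" using AB B by (auto simp: Fpow_def intro: finite_subset)
  note up = diversity_tight_span_upper[OF f]
  have f0: "f {} = 0" and ext: "f \<in> Fpow X \<rightarrow>\<^sub>E UNIV"
    using up by (auto simp: diversity_upper_functions_def)
  have fB: "0 \<le> f B" using diversity_upper_functions_ge[OF up B] nonneg[OF B] by linarith
  have ne: "A \<noteq> {}" using less fB f0 by auto
  define g where "g = f(A := f B)"
  have "\<delta> (\<Union>\<A>) \<le> (\<Sum>C\<in>\<A>. g C)" if fin: "finite \<A>" and sub: "\<A> \<subseteq> Fpow X" for \<A>
  proof (cases "A \<in> \<A>")
    case False
    then have "(\<Sum>C\<in>\<A>. g C) = (\<Sum>C\<in>\<A>. f C)" by (intro sum.cong) (auto simp: g_def)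
    then show ?thesis using diversity_upper_functionsD[OF up fin sub] by simp
  next
    case True
    define \<B> where "\<B> = \<A> - {A}"
    have \<B>: "finite \<B>" "\<B> \<subseteq> Fpow X" using fin sub by (auto simp: \<B>_def)
    have "(\<Sum>C\<in>\<A>. g C) = g A + (\<Sum>C\<in>\<B>. g C)"
      unfolding \<B>_def by (rule sum.remove[OF fin True])
    also have "(\<Sum>C\<in>\<B>. g C) = (\<Sum>C\<in>\<B>. f C)" by (intro sum.cong) (auto simp: g_def \<B>_def)
    finally have eq: "(\<Sum>C\<in>\<A>. g C) = f B + (\<Sum>C\<in>\<B>. f C)" by (simp add: g_def)
    have \<B>': "finite (insert B \<B>)" "insert B \<B> \<subseteq> Fpow X" using \<B> B by auto
    have "\<delta> (\<Union>\<A>) \<le> \<delta> (\<Union>(insert B \<B>))"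
      using AB by (intro mono Union_in_Fpow[OF \<B>']) (auto simp: \<B>_def)
    also have "\<dots> \<le> (\<Sum>C\<in>insert B \<B>. f C)" by (rule diversity_upper_functionsD[OF up \<B>'])
    also have "\<dots> \<le> f B + (\<Sum>C\<in>\<B>. f C)" using \<B>(1) fB by (simp add: sum.insert_if)
    finally show ?thesis using eq by simp
  qed
  moreover have "g \<in> Fpow X \<rightarrow>\<^sub>E UNIV" using ext A by (auto simp: g_def PiE_def extensional_def)
  moreover have "g {} = 0" using ne f0 by (simp add: g_def)
  ultimately have "g \<in> diversity_upper_functions X \<delta>" by (simp add: diversity_upper_functions_def)
  moreover have "\<forall>C\<in>Fpow X. g C \<le> f C" using less by (simp add: g_def)
  ultimately have "g = f" using f by (simp add: diversity_tight_span_def)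
  then have "g A = f A" by simp
  then show False using less by (simp add: g_def)
qed

section \<open>Extending functions from points to finite sets\<close>

text \<open>
  Putting the diameter inside the maximum makes the value at the empty set \<open>0\<close> without a case
  distinction.
\<close>

definition diameter_extension ::
  "'a set \<Rightarrow> ('a \<Rightarrow> 'a \<Rightarrow> real) \<Rightarrow> ('a \<Rightarrow> real) \<Rightarrow> 'a set \<Rightarrow> real" where
  "diameter_extension X d f = (\<lambda>A\<in>Fpow X. Max (insert (diam d A) (f ` A)))"

lemma diameter_extension_le_iff:
  "A \<in> Fpow X \<Longrightarrow> diameter_extension X d f A \<le> c \<longleftrightarrow> diam d A \<le> c \<and> (\<forall>a\<in>A. f a \<le> c)"
  by (simp add: diameter_extension_def FpowD)

lemma diam_le_diameter_extension: "A \<in> Fpow X \<Longrightarrow> diam d A \<le> diameter_extension X d f A"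
  using diameter_extension_le_iff[of A X d f "diameter_extension X d f A"] by blast

lemma le_diameter_extension: "A \<in> Fpow X \<Longrightarrow> a \<in> A \<Longrightarrow> f a \<le> diameter_extension X d f A"
  using diameter_extension_le_iff[of A X d f "diameter_extension X d f A"] by blast

context Metric_space
begin

lemma diameter_extension_nonneg: "A \<in> Fpow M \<Longrightarrow> 0 \<le> diameter_extension M d f A"
  using diam_le_diameter_extension[of A M d f] diam_nonneg[of A] FpowD[of A M] by linarith

lemma diameter_extension_singleton:
  assumes "f \<in> metric_upper_functions M d" "a \<in> M"
  shows "diameter_extension M d f {a} = f a"
  using assms metric_upper_functions_nonneg[OF assms]
  by (simp add: diameter_extension_def diam_singleton FpowI)

text \<open>
  The diameter of a nonempty union is a distance between two of its points, and these either share
  a member or lie in two different ones. Both estimates of such diameters below follow this split.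
\<close>

lemma diam_Union_cases:
  assumes fin: "finite \<A>" and sub: "\<A> \<subseteq> Fpow M"
  obtains "diam d (\<Union>\<A>) = 0"
    | A where "A \<in> \<A>" "diam d (\<Union>\<A>) \<le> diam d A"
    | A B a b where "A \<in> \<A>" "B \<in> \<A>" "A \<noteq> B" "a \<in> A" "b \<in> B" "diam d (\<Union>\<A>) = d a b"
proof (cases "\<Union>\<A> = {}")
  case True
  then have "diam d (\<Union>\<A>) = 0" by (simp only: diam_empty)
  then show ?thesis using that(1) by simp
next
  case False
  have "finite (\<Union>\<A>)" using FpowD(1)[OF Union_in_Fpow[OF fin sub]] .
  from diam_attained[OF this False, of d] obtain a b
    where ab: "a \<in> \<Union>\<A>" "b \<in> \<Union>\<A>" "diam d (\<Union>\<A>) = d a b" .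
  then obtain A B where AB: "A \<in> \<A>" "B \<in> \<A>" "a \<in> A" "b \<in> B" by blast
  show ?thesis
  proof (cases "A = B")
    case True
    then show ?thesis using that(2)[of A] AB ab(3) sub FpowD(1)[of A M] le_diam[of A a b d] by auto
  next
    case False
    then show ?thesis using that(3) AB ab(3) by blast
  qed
qed

lemma diameter_extension_upper:
  assumes f: "f \<in> metric_upper_functions M d"
  shows "diameter_extension M d f \<in> diversity_upper_functions M (diam d)"
proof -
  let ?E = "diameter_extension M d f"
  have "diam d (\<Union>\<A>) \<le> (\<Sum>A\<in>\<A>. ?E A)" if fin: "finite \<A>" and sub: "\<A> \<subseteq> Fpow M" for \<A>
  proof -
    have nn: "\<And>A. A \<in> \<A> \<Longrightarrow> 0 \<le> ?E A" using sub diameter_extension_nonneg by blast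
    from fin sub show ?thesis
    proof (cases rule: diam_Union_cases)
      case 1 then show ?thesis using nn by (simp add: sum_nonneg)
    next
      case (2 A)
      have "?E A \<le> (\<Sum>A\<in>\<A>. ?E A)" using fin nn 2 by (intro member_le_sum) auto
      then show ?thesis using 2 diam_le_diameter_extension[of A M d f] sub by fastforce
    next
      case (3 A B a b)
      have F: "A \<in> Fpow M" "B \<in> Fpow M" using 3 sub by auto
      have "d a b \<le> f a + f b" using 3 F by (intro metric_upper_functionsD[OF f]) (auto dest: FpowD)
      also have "\<dots> \<le> ?E A + ?E B"
        using 3 F le_diameter_extension[of A M a f d] le_diameter_extension[of B M b f d] by simp
      also have "\<dots> = (\<Sum>A\<in>{A,B}. ?E A)" using 3 by simp
      also have "\<dots> \<le> (\<Sum>A\<in>\<A>. ?E A)" using fin nn 3 by (intro sum_mono2) auto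
      finally show ?thesis using 3 by simp
    qed
  qed
  moreover have "?E {} = 0" by (simp add: diameter_extension_def FpowI)
  moreover have "?E \<in> Fpow M \<rightarrow>\<^sub>E UNIV" by (simp add: diameter_extension_def)
  ultimately show ?thesis by (simp add: diversity_upper_functions_def)
qed

lemma singleton_values_upper:
  assumes g: "g \<in> diversity_upper_functions M (diam d)"
  shows "(\<lambda>x\<in>M. g {x}) \<in> metric_upper_functions M d"
proof -
  have "d a b \<le> g {a} + g {b}" if ab: "a \<in> M" "b \<in> M" for a b
  proof (cases "a = b")
    case True
    then show ?thesis using diversity_upper_functions_ge[OF g, of "{a}"] ab
      by (simp add: diam_singleton FpowI)
  next
    case False
    then have "diam d ({a} \<union> {b}) \<le> g {a} + g {b}"
      using ab by (intro diversity_upper_functions_ge_pair[OF g]) (auto simp: FpowI)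
    moreover have "d a b \<le> diam d ({a} \<union> {b})" by (rule le_diam) auto
    ultimately show ?thesis by simp
  qed
  then show ?thesis by (simp add: metric_upper_functions_def)
qed

text \<open>
  A smaller upper function \<open>g\<close> agrees with \<open>f\<close> on points because \<open>f\<close> is minimal. At a set \<open>A\<close>
  containing \<open>a\<close> the constant \<open>c = g A\<close> then satisfies \<open>d a b \<le> c + f b\<close> for all \<open>b\<close>, which forces
  \<open>f a \<le> g A\<close>.
\<close>

lemma diameter_extension_in_tight_span:
  assumes f: "f \<in> metric_tight_span M d"
  shows "diameter_extension M d f \<in> diversity_tight_span M (diam d)"
proof -
  let ?E = "diameter_extension M d f"
  note fu = metric_tight_span_upper[OF f]
  have "g = ?E" if g: "g \<in> diversity_upper_functions M (diam d)"
    and le: "\<forall>A\<in>Fpow M. g A \<le> ?E A" for g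
  proof -
    have "(\<lambda>x\<in>M. g {x}) = f"
    proof -
      have "g {x} \<le> f x" if "x \<in> M" for x
        using bspec[OF le, of "{x}"] diameter_extension_singleton[OF fu that] that by (simp add: FpowI)
      then have "\<forall>x\<in>M. (\<lambda>x\<in>M. g {x}) x \<le> f x" by simp
      then show ?thesis using f singleton_values_upper[OF g] by (simp add: metric_tight_span_def)
    qed
    then have pt: "g {x} = f x" if "x \<in> M" for x using that by (metis restrict_apply')
    have ge: "?E A \<le> g A" if A: "A \<in> Fpow M" for A
    proof -
      have dA: "diam d A \<le> g A" by (rule diversity_upper_functions_ge[OF g A])
      have "f a \<le> g A" if a: "a \<in> A" for a
      proof (rule metric_tight_span_le[OF f])
        show "a \<in> M" using a FpowD[OF A] by blast
        show "0 \<le> g A" using dA diam_nonneg[of A] FpowD[OF A] by linarith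
        fix b assume b: "b \<in> M"
        show "d a b \<le> g A + f b"
        proof (cases "A = {b}")
          case True
          then show ?thesis using a b pt metric_upper_functions_nonneg[OF fu b] by simp
        next
          case False
          have "d a b \<le> diam d (A \<union> {b})" using a FpowD[OF A] by (intro le_diam) auto
          also have "\<dots> \<le> g A + g {b}"
            using False A b by (intro diversity_upper_functions_ge_pair[OF g]) (auto simp: FpowI)
          finally show ?thesis using pt[OF b] by simp
        qed
      qed
      then show ?thesis using dA by (simp add: diameter_extension_le_iff[OF A])
    qed
    have "g \<in> extensional (Fpow M)" using g by (auto simp: diversity_upper_functions_def PiE_def)
    moreover have "?E \<in> extensional (Fpow M)" by (simp add: diameter_extension_def)
    ultimately show ?thesis using le ge by (intro extensionalityI) (auto intro: antisym)
  qed
  then show ?thesis using diameter_extension_upper[OF fu] by (simp add: diversity_tight_span_def)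
qed

text \<open>
  Monotonicity puts the extension of the singleton values below \<open>g\<close>, so minimality of \<open>g\<close> gives
  equality. A smaller function on points would have a smaller extension, so the singleton values
  are minimal too.
\<close>

lemma diversity_tight_span_is_extension:
  assumes g: "g \<in> diversity_tight_span M (diam d)"
  obtains f where "f \<in> metric_tight_span M d" "diameter_extension M d f = g"
proof -
  let ?E = "diameter_extension M d"
  define f where "f = (\<lambda>x\<in>M. g {x})"
  note gu = diversity_tight_span_upper[OF g]
  have fu: "f \<in> metric_upper_functions M d" unfolding f_def by (rule singleton_values_upper[OF gu])
  have min: "?E h = g"
    if h: "h \<in> metric_upper_functions M d" and le: "\<forall>x\<in>M. h x \<le> f x" for h
  proof -
    have "?E h A \<le> g A" if A: "A \<in> Fpow M" for A
    proof -
      have "h a \<le> g A" if a: "a \<in> A" for a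
      proof -
        have aM: "a \<in> M" using a FpowD[OF A] by blast
        have "g {a} \<le> g A"
          using a by (intro diversity.diversity_tight_span_mono[OF diversity_diam g _ A]) simp
        then show ?thesis using bspec[OF le aM] aM by (simp add: f_def)
      qed
      then show ?thesis
        using diversity_upper_functions_ge[OF gu A] by (simp add: diameter_extension_le_iff[OF A])
    qed
    then show ?thesis
      using g diameter_extension_upper[OF h] by (simp add: diversity_tight_span_def)
  qed
  have "h = f" if h: "h \<in> metric_upper_functions M d" and le: "\<forall>x\<in>M. h x \<le> f x" for h
  proof (rule extensionalityI)
    show "h \<in> extensional M" "f \<in> extensional M"
      using h fu by (auto simp: metric_upper_functions_def PiE_def)
    fix x assume x: "x \<in> M"
    have "h x = ?E h {x}" using diameter_extension_singleton[OF h x] by simp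
    also have "\<dots> = ?E f {x}" using min[OF h le] min[OF fu] by simp
    also have "\<dots> = f x" by (rule diameter_extension_singleton[OF fu x])
    finally show "h x = f x" .
  qed
  then have "f \<in> metric_tight_span M d" using fu by (simp add: metric_tight_span_def)
  moreover have "?E f = g" using min[OF fu] by simp
  ultimately show ?thesis using that by blast
qed

lemma bij_betw_diameter_extension:
  "bij_betw (diameter_extension M d) (metric_tight_span M d) (diversity_tight_span M (diam d))"
  unfolding bij_betw_def
proof
  show "inj_on (diameter_extension M d) (metric_tight_span M d)"
  proof (rule inj_onI)
    fix f g assume f: "f \<in> metric_tight_span M d" and g: "g \<in> metric_tight_span M d"
      and eq: "diameter_extension M d f = diameter_extension M d g"
    note u = metric_tight_span_upper[OF f] metric_tight_span_upper[OF g]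
    show "f = g"
    proof (rule extensionalityI)
      show "f \<in> extensional M" "g \<in> extensional M"
        using u by (auto simp: metric_upper_functions_def PiE_def)
      show "f x = g x" if "x \<in> M" for x
        using diameter_extension_singleton[OF u(1) that] diameter_extension_singleton[OF u(2) that] eq
        by simp
    qed
  qed
  show "diameter_extension M d ` metric_tight_span M d = diversity_tight_span M (diam d)"
    using diameter_extension_in_tight_span diversity_tight_span_is_extension by blast
qed

section \<open>The supremum distance\<close>

text \<open>
  Functions in the tight span are 1-Lipschitz, so \<open>f x \<le> f y + d x y\<close>, while
  \<open>g x \<ge> d x y - g y\<close>; the difference is bounded in terms of a base point \<open>y\<close>.
\<close>

lemma metric_tight_span_diff_le:
  assumes f: "f \<in> metric_tight_span M d" and g: "g \<in> metric_tight_span M d"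
    and x: "x \<in> M" and y: "y \<in> M"
  shows "f x - g x \<le> f y + g y"
proof -
  note fu = metric_tight_span_upper[OF f] and gu = metric_tight_span_upper[OF g]
  have "f x \<le> f y + d x y"
  proof (rule metric_tight_span_le[OF f x])
    show "0 \<le> f y + d x y" using metric_upper_functions_nonneg[OF fu y] by simp
    show "d x b \<le> f y + d x y + f b" if "b \<in> M" for b
      using metric_upper_functionsD[OF fu y that] triangle[OF x y that] by simp
  qed
  then show ?thesis using metric_upper_functionsD[OF gu x y] by simp
qed

lemma bdd_above_metric_tight_span_diff:
  assumes f: "f \<in> metric_tight_span M d" and g: "g \<in> metric_tight_span M d"
  shows "bdd_above ((\<lambda>x. \<bar>f x - g x\<bar>) ` M)"
proof (cases "M = {}")
  case False
  then obtain y where y: "y \<in> M" by blast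
  have "\<bar>f x - g x\<bar> \<le> f y + g y" if x: "x \<in> M" for x
    using metric_tight_span_diff_le[OF f g x y] metric_tight_span_diff_le[OF g f x y] by linarith
  then show ?thesis by (intro bdd_aboveI2) auto
qed simp

lemma abs_diff_le_metric_tight_span_dist:
  assumes "f \<in> metric_tight_span M d" "g \<in> metric_tight_span M d" "x \<in> M"
  shows "\<bar>f x - g x\<bar> \<le> metric_tight_span_dist M d f g"
  using assms cSUP_upper[OF assms(3) bdd_above_metric_tight_span_diff[OF assms(1,2)]]
  by (auto simp: metric_tight_span_dist_def)

lemma metric_tight_span_dist_le:
  assumes "0 \<le> c" "\<And>x. x \<in> M \<Longrightarrow> \<bar>f x - g x\<bar> \<le> c"
  shows "metric_tight_span_dist M d f g \<le> c"
  using assms by (auto simp: metric_tight_span_dist_def intro!: cSUP_least)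

lemma metric_tight_span_dist_nonneg: "0 \<le> metric_tight_span_dist M d f g"
proof (cases "M \<noteq> {} \<and> f \<in> metric_tight_span M d \<and> g \<in> metric_tight_span M d")
  case True
  then obtain x where "x \<in> M" by blast
  then show ?thesis using abs_diff_le_metric_tight_span_dist[of f g x] True by linarith
qed (auto simp: metric_tight_span_dist_def)

lemma Metric_space_metric_tight_span:
  "Metric_space (metric_tight_span M d) (metric_tight_span_dist M d)"
proof
  show "0 \<le> metric_tight_span_dist M d f g" for f g by (rule metric_tight_span_dist_nonneg)
  show "metric_tight_span_dist M d f g = metric_tight_span_dist M d g f" for f g
    by (auto simp: metric_tight_span_dist_def abs_minus_commute)
next
  fix f g assume f: "f \<in> metric_tight_span M d" and g: "g \<in> metric_tight_span M d"
  show "metric_tight_span_dist M d f g = 0 \<longleftrightarrow> f = g"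
  proof
    assume 0: "metric_tight_span_dist M d f g = 0"
    show "f = g"
    proof (rule extensionalityI)
      show "f \<in> extensional M" "g \<in> extensional M"
        using metric_tight_span_upper[OF f] metric_tight_span_upper[OF g]
        by (auto simp: metric_upper_functions_def PiE_def)
      show "f x = g x" if "x \<in> M" for x
        using abs_diff_le_metric_tight_span_dist[OF f g that] 0 by simp
    qed
  next
    assume "f = g"
    then have "metric_tight_span_dist M d f g \<le> 0" by (intro metric_tight_span_dist_le) auto
    then show "metric_tight_span_dist M d f g = 0"
      using metric_tight_span_dist_nonneg[of f g] by linarith
  qed
next
  fix f g h assume f: "f \<in> metric_tight_span M d" and g: "g \<in> metric_tight_span M d"
    and h: "h \<in> metric_tight_span M d"
  show "metric_tight_span_dist M d f h
      \<le> metric_tight_span_dist M d f g + metric_tight_span_dist M d g h"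
  proof (rule metric_tight_span_dist_le)
    show "\<bar>f x - h x\<bar> \<le> metric_tight_span_dist M d f g + metric_tight_span_dist M d g h"
      if "x \<in> M" for x
      using abs_diff_le_metric_tight_span_dist[OF f g that]
        abs_diff_le_metric_tight_span_dist[OF g h that] by linarith
  qed (simp add: metric_tight_span_dist_nonneg)
qed

section \<open>The tight span diversity as a diameter\<close>

lemma INF_extension_le:
  assumes "finite S" "f \<in> S"
  shows "(INF F\<in>diameter_extension M d ` S. F A) \<le> diameter_extension M d f A"
  using assms by (intro cINF_lower) auto

lemma INF_extension_attained:
  assumes "finite S" "S \<noteq> {}"
  obtains f where "f \<in> S" "(INF F\<in>diameter_extension M d ` S. F A) = diameter_extension M d f A"
proof -
  let ?V = "(\<lambda>F. F A) ` diameter_extension M d ` S"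
  have "Inf ?V \<in> ?V" using assms cInf_eq_Min[of ?V] Min_in[of ?V] by simp
  then show ?thesis using that by blast
qed

text \<open>
  Only the two members that contain the points realizing the diameter contribute, and the infima
  over \<open>S\<close> are attained there at some \<open>f\<close> and \<open>g\<close>; then \<open>d a b - f a - g b \<le> f b - g b\<close>.
\<close>

lemma diversity_tight_span_term_le_diam:
  assumes S: "finite S" "S \<noteq> {}" "S \<subseteq> metric_tight_span M d"
    and fin: "finite \<A>" and sub: "\<A> \<subseteq> Fpow M"
  shows "diam d (\<Union>\<A>) - (\<Sum>A\<in>\<A>. INF F\<in>diameter_extension M d ` S. F A)
    \<le> diam (metric_tight_span_dist M d) S"
proof -
  let ?E = "diameter_extension M d" and ?D = "diam (metric_tight_span_dist M d) S"
  define m where "m A = (INF F\<in>?E ` S. F A)" for A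
  have D: "0 \<le> ?D" by (rule Metric_space.diam_nonneg[OF Metric_space_metric_tight_span S(1)])
  have m: "\<exists>f\<in>S. m A = ?E f A" for A using INF_extension_attained[OF S(1,2)] m_def by metis
  have nn: "0 \<le> m A" if "A \<in> \<A>" for A
    using m[of A] that sub diameter_extension_nonneg[of A] by auto
  have "diam d (\<Union>\<A>) \<le> (\<Sum>A\<in>\<A>. m A) + ?D"
    using fin sub
  proof (cases rule: diam_Union_cases)
    case 1 then show ?thesis using nn D by (simp add: sum_nonneg)
  next
    case (2 A)
    have "m A \<le> (\<Sum>A\<in>\<A>. m A)" using fin nn 2 by (intro member_le_sum) auto
    moreover have "diam d A \<le> m A" using m[of A] 2 sub diam_le_diameter_extension[of A M d] by auto
    ultimately show ?thesis using 2 D by linarith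
  next
    case (3 A B a b)
    have F: "A \<in> Fpow M" "B \<in> Fpow M" using 3 sub by auto
    have ab: "a \<in> M" "b \<in> M" using 3 F by (auto dest: FpowD)
    obtain f g where fg: "f \<in> S" "g \<in> S" "m A = ?E f A" "m B = ?E g B" using m by meson
    have T: "f \<in> metric_tight_span M d" "g \<in> metric_tight_span M d" using fg S(3) by auto
    have "f b - g b \<le> ?D"
      using abs_diff_le_metric_tight_span_dist[OF T ab(2)]
        le_diam[OF S(1) fg(1,2), of "metric_tight_span_dist M d"] by linarith
    moreover have "d a b \<le> f a + f b"
      by (rule metric_upper_functionsD[OF metric_tight_span_upper[OF T(1)] ab])
    moreover have "f a \<le> m A" "g b \<le> m B" using 3 F fg by (auto intro: le_diameter_extension)
    moreover have "m A + m B = (\<Sum>A\<in>{A,B}. m A)" using 3 by simp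
    moreover have "\<dots> \<le> (\<Sum>A\<in>\<A>. m A)" using fin nn 3 by (intro sum_mono2) auto
    ultimately show ?thesis using 3 by linarith
  qed
  then show ?thesis by (simp add: m_def)
qed

lemma diversity_tight_span_div_eq_diam:
  assumes S: "S \<in> Fpow (metric_tight_span M d)"
  shows "diversity_tight_span_div M (diam d) (diameter_extension M d ` S)
    = diam (metric_tight_span_dist M d) S"
proof (cases "S = {}")
  case True
  then show ?thesis by (simp add: diversity_tight_span_div_def)
next
  case ne: False
  let ?E = "diameter_extension M d" and ?D = "diam (metric_tight_span_dist M d) S"
  note fin = FpowD(1)[OF S] and sub = FpowD(2)[OF S]
  define m where "m A = (INF F\<in>?E ` S. F A)" for A
  define V where "V = {diam d (\<Union>\<A>) - (\<Sum>A\<in>\<A>. m A) | \<A>. \<A> \<subseteq> Fpow M \<and> finite \<A>}"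
  have "?E ` S \<in> Fpow (diversity_tight_span M (diam d))"
    using fin sub diameter_extension_in_tight_span by (intro FpowI) auto
  then have eq: "diversity_tight_span_div M (diam d) (?E ` S) = Sup V"
    using ne by (simp add: diversity_tight_span_div_def V_def m_def)
  have le: "v \<le> ?D" if "v \<in> V" for v
    using that diversity_tight_span_term_le_diam[OF fin ne sub] by (auto simp: V_def m_def)
  then have "bdd_above V" by (rule bdd_aboveI)
  then have up: "diam d (\<Union>\<A>) - (\<Sum>A\<in>\<A>. m A) \<le> Sup V" if "finite \<A>" "\<A> \<subseteq> Fpow M" for \<A>
    using that by (intro cSup_upper) (auto simp: V_def)
  have s0: "0 \<le> Sup V" using up[of "{}"] by simp
  have half: "f x - g x \<le> Sup V" if f: "f \<in> S" and g: "g \<in> S" and x: "x \<in> M" for f g x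
  proof -
    have fT: "f \<in> metric_tight_span M d" and gT: "g \<in> metric_tight_span M d" using f g sub by auto
    note fu = metric_tight_span_upper[OF fT] and gu = metric_tight_span_upper[OF gT]
    have "f x \<le> Sup V + g x"
    proof (rule metric_tight_span_le[OF fT x])
      show 0: "0 \<le> Sup V + g x" using s0 metric_upper_functions_nonneg[OF gu x] by simp
      fix b assume b: "b \<in> M"
      show "d x b \<le> Sup V + g x + f b"
      proof (cases "x = b")
        case True
        then show ?thesis using 0 b metric_upper_functions_nonneg[OF fu b] by simp
      next
        case False
        have "diam d (\<Union>{{x},{b}}) - (\<Sum>A\<in>{{x},{b}}. m A) \<le> Sup V"
          using x b by (intro up) (auto simp: FpowI)
        moreover have "d x b \<le> diam d (\<Union>{{x},{b}})" by (rule le_diam) auto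
        moreover have "m {x} \<le> g x"
          using INF_extension_le[OF fin g, of "{x}"] diameter_extension_singleton[OF gu x]
          by (simp add: m_def)
        moreover have "m {b} \<le> f b"
          using INF_extension_le[OF fin f, of "{b}"] diameter_extension_singleton[OF fu b]
          by (simp add: m_def)
        ultimately show ?thesis using False by simp
      qed
    qed
    then show ?thesis by simp
  qed
  obtain f g where fg: "f \<in> S" "g \<in> S" "?D = metric_tight_span_dist M d f g"
    by (rule diam_attained[OF fin ne, of "metric_tight_span_dist M d"])
  have "metric_tight_span_dist M d f g \<le> Sup V"
    using half[OF fg(1,2)] half[OF fg(2,1)] s0
    by (intro metric_tight_span_dist_le) (auto simp: abs_le_iff)
  moreover have "V \<noteq> {}" by (auto simp: V_def)
  then have "Sup V \<le> ?D" using le by (rule cSup_least)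
  ultimately show ?thesis using eq fg(3) by simp
qed

lemma diversity_tight_span_div_pair:
  assumes "f \<in> metric_tight_span M d" "g \<in> metric_tight_span M d"
  shows "diversity_tight_span_div M (diam d) {diameter_extension M d f, diameter_extension M d g}
    = metric_tight_span_dist M d f g"
proof -
  interpret T: Metric_space "metric_tight_span M d" "metric_tight_span_dist M d"
    by (rule Metric_space_metric_tight_span)
  have "diam (metric_tight_span_dist M d) {f, g} = metric_tight_span_dist M d f g"
  proof (rule antisym)
    obtain a b where "a \<in> {f, g}" "b \<in> {f, g}"
      "diam (metric_tight_span_dist M d) {f, g} = metric_tight_span_dist M d a b"
      by (rule diam_attained[of "{f, g}" "metric_tight_span_dist M d"]) auto
    then show "diam (metric_tight_span_dist M d) {f, g} \<le> metric_tight_span_dist M d f g"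
      using assms T.nonneg[of f g] T.commute[of f g] by auto
  qed (rule le_diam, auto)
  then show ?thesis using diversity_tight_span_div_eq_diam[of "{f, g}"] assms by (simp add: FpowI)
qed

end

section \<open>Transport along bijections\<close>

lemma diversity_transport:
  assumes div: "diversity Y1 \<delta>1" and bij: "bij_betw \<pi> Y1 Y2"
    and eq: "\<And>A. A \<in> Fpow Y1 \<Longrightarrow> \<delta>2 (\<pi> ` A) = \<delta>1 A"
  shows "diversity Y2 \<delta>2"
proof -
  interpret diversity Y1 \<delta>1 by (rule div)
  have pre: "\<exists>A'\<in>Fpow Y1. A = \<pi> ` A' \<and> card A = card A'" if A: "A \<in> Fpow Y2" for A
  proof -
    have "A \<subseteq> \<pi> ` Y1" using FpowD(2)[OF A] bij_betw_imp_surj_on[OF bij] by simp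
    then obtain A' where A': "A' \<subseteq> Y1" "finite A'" "A = \<pi> ` A'"
      using FpowD(1)[OF A] by (meson finite_subset_image)
    moreover have "card (\<pi> ` A') = card A'"
      using A'(1) bij by (meson bij_betw_imp_inj_on card_image inj_on_subset)
    ultimately show ?thesis by (intro bexI[of _ A']) (auto intro: FpowI)
  qed
  show ?thesis
  proof
    fix A assume "A \<in> Fpow Y2"
    then obtain A' where A': "A' \<in> Fpow Y1" "A = \<pi> ` A'" "card A = card A'" using pre by meson
    show "0 \<le> \<delta>2 A" using A' eq nonneg by simp
    show "\<delta>2 A = 0 \<longleftrightarrow> card A \<le> 1" using A' eq zero_iff[OF A'(1)] by simp
  next
    fix A B C assume "A \<in> Fpow Y2" "B \<in> Fpow Y2" "C \<in> Fpow Y2" "B \<noteq> {}"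
    then obtain A' B' C' where 1: "A' \<in> Fpow Y1" "B' \<in> Fpow Y1" "C' \<in> Fpow Y1"
      and 2: "A = \<pi> ` A'" "B = \<pi> ` B'" "C = \<pi> ` C'" and ne: "B' \<noteq> {}"
      using pre by (metis image_is_empty)
    have "A' \<union> C' \<in> Fpow Y1" "A' \<union> B' \<in> Fpow Y1" "B' \<union> C' \<in> Fpow Y1"
      using 1 by (auto simp: Fpow_def)
    then have "\<delta>2 (A \<union> C) = \<delta>1 (A' \<union> C')" "\<delta>2 (A \<union> B) = \<delta>1 (A' \<union> B')"
      "\<delta>2 (B \<union> C) = \<delta>1 (B' \<union> C')"
      by (simp_all add: 2 eq flip: image_Un)
    then show "\<delta>2 (A \<union> C) \<le> \<delta>2 (A \<union> B) + \<delta>2 (B \<union> C)" using triangle[OF 1 ne] by simp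
  qed
qed

text \<open>
  Nonnegativity and symmetry are required everywhere because the locale \<^const>\<open>Metric_space\<close>
  demands them also off the carrier, where the bijection gives no information.
\<close>

lemma Metric_space_transport:
  assumes met: "Metric_space M1 d1" and bij: "bij_betw \<phi> M1 M2"
    and eq: "\<And>x y. x \<in> M1 \<Longrightarrow> y \<in> M1 \<Longrightarrow> d2 (\<phi> x) (\<phi> y) = d1 x y"
    and nn: "\<And>x y. 0 \<le> d2 x y" and sym: "\<And>x y. d2 x y = d2 y x"
  shows "Metric_space M2 d2"
proof -
  interpret Metric_space M1 d1 by (rule met)
  have pre: "\<exists>x'\<in>M1. x = \<phi> x'" if "x \<in> M2" for x using that bij by (auto simp: bij_betw_def)
  show ?thesis
  proof
    fix x y assume "x \<in> M2" "y \<in> M2"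
    then obtain x' y' where 1: "x' \<in> M1" "y' \<in> M1" "x = \<phi> x'" "y = \<phi> y'" using pre by meson
    then have "x = y \<longleftrightarrow> x' = y'" using bij by (meson bij_betw_imp_inj_on inj_on_eq_iff)
    then show "d2 x y = 0 \<longleftrightarrow> x = y" using 1 eq by simp
  next
    fix x y z assume "x \<in> M2" "y \<in> M2" "z \<in> M2"
    then obtain x' y' z' where 1: "x' \<in> M1" "y' \<in> M1" "z' \<in> M1" "x = \<phi> x'" "y = \<phi> y'" "z = \<phi> z'"
      using pre by meson
    then show "d2 x z \<le> d2 x y + d2 y z" using eq triangle[OF 1(1-3)] by simp
  qed (fact nn sym)+
qed

theorem theorem4p3:
  fixes X :: "'a set" and d :: "'a \<Rightarrow> 'a \<Rightarrow> real"
  assumes "Metric_space X d"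
  shows "isometric_metric_spaces
           (diversity_tight_span X (diam d))
           (\<lambda>f g. diversity_tight_span_div X (diam d) {f, g})
           (metric_tight_span X d) (metric_tight_span_dist X d)
       \<and> isomorphic_diversities
           (metric_tight_span X d) (diam (metric_tight_span_dist X d))
           (diversity_tight_span X (diam d)) (diversity_tight_span_div X (diam d))"
proof -
  interpret Metric_space X d by (rule assms)
  let ?E = "diameter_extension X d"
  let ?T = "metric_tight_span X d" and ?dT = "metric_tight_span_dist X d"
  let ?U = "diversity_tight_span X (diam d)" and ?\<delta>T = "diversity_tight_span_div X (diam d)"
  note bij = bij_betw_diameter_extension and eq = diversity_tight_span_div_eq_diam
    and pair = diversity_tight_span_div_pair
  have divT: "diversity ?T (diam ?dT)"
    by (rule Metric_space.diversity_diam[OF Metric_space_metric_tight_span])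
  have divU: "diversity ?U ?\<delta>T" by (rule diversity_transport[OF divT bij eq])
  have metU: "Metric_space ?U (\<lambda>f g. ?\<delta>T {f, g})"
  proof (rule Metric_space_transport[OF Metric_space_metric_tight_span bij])
    fix f g
    show "?\<delta>T {?E f, ?E g} = ?dT f g" if "f \<in> ?T" "g \<in> ?T" using that by (rule pair)
  next
    fix F G
    show "0 \<le> ?\<delta>T {F, G}"
      using diversity.nonneg[OF divU, of "{F, G}"]
      by (cases "{F, G} \<in> Fpow ?U") (auto simp: diversity_tight_span_div_def)
    show "?\<delta>T {F, G} = ?\<delta>T {G, F}" by (simp add: insert_commute)
  qed
  let ?R = "inv_into ?T ?E"
  have "?dT (?R F) (?R G) = ?\<delta>T {F, G}" if "F \<in> ?U" "G \<in> ?U" for F G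
  proof -
    have "?R F \<in> ?T" "?R G \<in> ?T" "?E (?R F) = F" "?E (?R G) = G"
      using that bij_betw_apply[OF bij_betw_inv_into[OF bij]] bij_betw_inv_into_right[OF bij] by auto
    then show ?thesis using pair[of "?R F" "?R G"] by simp
  qed
  then have "isometric_metric_spaces ?U (\<lambda>f g. ?\<delta>T {f, g}) ?T ?dT"
    using metU Metric_space_metric_tight_span bij_betw_inv_into[OF bij]
    unfolding isometric_metric_spaces_def by blast
  moreover have "isomorphic_diversities ?T (diam ?dT) ?U ?\<delta>T"
    using divT divU bij eq unfolding isomorphic_diversities_def diversity_isomorphism_def by metis
  ultimately show ?thesis by blast
qed

end
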